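(* Let $Q>1$ be a power of $2$. If $u,v\in\mathbb{F}_{Q^3}^*$ satisfy $u^{Q-1}+v^{Q-1}=1$, then $uv$ is a cube in $\mathbb{F}_{Q^3}$. *)

theory Defs
  imports Complex_Main "HOL-Library.Cardinality"
begin

end

theory Submission
  imports Defs "HOL-Computational_Algebra.Polynomial" "HOL-Computational_Algebra.Primes"
begin

text \<open>
  If \<open>Q \<equiv> 2 (mod 3)\<close>, every element is a cube. Let \<open>Q \<equiv> 1 (mod 3)\<close> and put \<open>a = u\<^bsup>Q-1\<^esup>\<close>,
  \<open>b = v\<^bsup>Q-1\<^esup> = 1 + a\<close>, \<open>c = a\<^bsup>Q\<^esup>\<close>. Both \<open>a\<close> and \<open>1 + a\<close> have norm \<open>1\<close> over the field with \<open>Q\<close>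
  elements. Eliminating the third conjugate of \<open>a\<close> from the two norm equations leaves an equation
  in \<open>a\<close> and \<open>c\<close> that factors in characteristic 2 as \<open>(c (1 + a) - 1) (a c - (1 + a)) = 0\<close>. (The
  minimal polynomial of \<open>a\<close> is a simplest cubic, whose roots are permuted by \<open>x \<mapsto> 1 / (1 + x)\<close>.)
  In the two cases \<open>v u\<^bsup>Q\<^esup>\<close> respectively \<open>v / u\<^bsup>Q+1\<^esup>\<close> has \<open>(Q - 1)\<close>-th power \<open>1\<close>, hence is a
  cube because \<open>3\<close> divides \<open>1 + Q + Q\<^sup>2\<close>; and it differs from \<open>u v\<close> by the cube \<open>u\<^bsup>Q-1\<^esup>\<close>
  respectively \<open>u\<^bsup>Q+2\<^esup>\<close>.
\<close>

lemma card_nth_roots_le: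
  fixes c :: "'a::idom"
  assumes "n > 0"
  shows "card {x. x ^ n = c} \<le> n"
proof -
  let ?p = "monom 1 n - [:c:]"
  have "coeff ?p n = 1"
    using assms by (cases n) simp_all
  hence "?p \<noteq> 0"
    by (metis coeff_0 zero_neq_one)
  moreover have "degree ?p \<le> n"
    by (intro degree_diff_le) (simp_all add: degree_monom_le)
  moreover have "{x. poly ?p x = 0} = {x. x ^ n = c}"
    by (simp add: poly_monom)
  ultimately show ?thesis
    by (metis card_poly_roots_bound le_trans)
qed

lemma finite_field_power_card_minus_1:
  fixes x :: "'a::{field,finite}"
  assumes "x \<noteq> 0"
  shows "x ^ (CARD('a) - 1) = 1"
proof -
  have "(\<Prod>y\<in>UNIV - {0}. x * y) = (\<Prod>y\<in>UNIV - {0}. y)"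
    by (rule prod.reindex_bij_witness[of _ "\<lambda>y. y / x" "\<lambda>y. x * y"]) (use assms in auto)
  thus ?thesis
    by (simp add: prod.distrib)
qed

text \<open>The nonzero \<open>d\<close>-th powers are among the at most \<open>n\<close> roots of \<open>X ^ n - 1\<close>; since
  each fibre of \<open>x \<mapsto> x ^ d\<close> has at most \<open>d\<close> elements, there are at least \<open>n\<close> of them.\<close>

lemma finite_field_nth_power_if_power_eq_1:
  fixes x :: "'a::{field,finite}"
  assumes card: "CARD('a) - 1 = d * n" and x: "x ^ n = 1"
  shows "\<exists>w. x = w ^ d"
proof -
  have "CARD('a) \<ge> 2"
    using card_mono[of "UNIV :: 'a set" "{0, 1}"] by simp
  hence pos: "d > 0" "n > 0"
    using card by (auto intro!: Nat.gr0I)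
  define P where "P = (\<lambda>w::'a. w ^ d) ` (-{0})"
  have "P \<subseteq> {y. y ^ n = 1}"
    using finite_field_power_card_minus_1[where 'a = 'a] card
    by (auto simp: P_def simp flip: power_mult)
  moreover have "n \<le> card P"
  proof -
    have "d * n = card (-{0::'a})"
      using card by (simp add: Compl_eq_Diff_UNIV card_Diff_singleton)
    also have "-{0::'a} \<subseteq> (\<Union>y\<in>P. {w. w ^ d = y})"
      by (auto simp: P_def)
    hence "card (-{0::'a}) \<le> card (\<Union>y\<in>P. {w. w ^ d = y})"
      by (intro card_mono) auto
    also have "\<dots> \<le> (\<Sum>y\<in>P. card {w. w ^ d = y})"
      by (intro card_UN_le) simp
    also have "\<dots> \<le> (\<Sum>y\<in>P. d)"
      by (intro sum_mono card_nth_roots_le pos)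
    finally show ?thesis
      using pos by simp
  qed
  ultimately have "P = {y. y ^ n = 1}"
    using card_nth_roots_le[OF pos(2), of "1::'a"]
    by (intro card_seteq) auto
  with x have "x \<in> P"
    by simp
  thus ?thesis
    by (auto simp: P_def)
qed

lemma finite_field_cube_if_card_mod_3_eq_2:
  fixes x :: "'a::{field,finite}"
  assumes "CARD('a) mod 3 = 2"
  shows "\<exists>w. x = w ^ 3"
proof (cases "x = 0")
  case True
  thus ?thesis
    by (intro exI[of _ 0]) simp
next
  case False
  obtain m where m: "CARD('a) = 3 * m + 2"
    using assms by (metis mult_div_mod_eq)
  \<comment> \<open>The exponent \<open>2 * m + 1\<close> inverts 3 modulo the group order
    \<open>3 * m + 1\<close>.\<close>
  have "(x ^ (2 * m + 1)) ^ 3 = x * (x ^ (3 * m + 1)) ^ 2"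
    by (simp add: algebra_simps flip: power_mult power_Suc) (simp add: numeral_3_eq_3)
  also have "\<dots> = x"
    using finite_field_power_card_minus_1[OF False] m by simp
  finally show ?thesis
    by metis
qed

lemma finite_field_CHAR_eq_2:
  assumes "even CARD('a::{field,finite})"
  shows "CHAR('a) = 2"
proof -
  have "odd (CARD('a) - 1)"
    using assms by simp
  \<comment> \<open>An odd power of -1 is -1, yet the group order is an exponent giving 1.\<close>
  hence "(-1 :: 'a) = 1"
    using finite_field_power_card_minus_1[of "-1 :: 'a"] by simp
  hence "of_nat 2 = (0 :: 'a)"
    by (metis add.right_inverse of_nat_numeral one_add_one)
  hence "CHAR('a) dvd 2"
    by (simp only: of_nat_eq_0_iff_char_dvd)
  moreover have "CHAR('a) \<noteq> 1"
    by simp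
  ultimately show ?thesis
    using two_is_prime_nat unfolding prime_nat_iff by blast
qed

theorem theorem2:
  fixes u v :: "'a::{field,finite}" and Q :: nat
  assumes "Q > 1" and "\<exists>k::nat. Q = 2 ^ k"
    and "CARD('a) = Q ^ 3"
    and "u \<noteq> 0" and "v \<noteq> 0"
    and "u ^ (Q - 1) + v ^ (Q - 1) = 1"
  shows "\<exists>w. u * v = w ^ 3"
proof (cases "Q mod 3 = 1")
  case False
  obtain k where k: "Q = 2 ^ k"
    using assms by blast
  have "coprime 3 Q"
    by (simp add: k)
  hence "Q mod 3 \<noteq> 0"
    by (auto simp: coprime_iff_gcd_eq_1 mod_eq_0_iff_dvd gcd_nat.absorb1)
  with False have "Q mod 3 = 2"
    by linarith
  hence "Q ^ 3 mod 3 = 2"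
    by (simp flip: power_mod[of Q])
  thus ?thesis
    using assms(3) finite_field_cube_if_card_mod_3_eq_2 by metis
next
  case True
  hence "Q = Suc (3 * (Q div 3))"
    by presburger
  then obtain r where r: "Q = Suc (3 * r)" ..
  obtain k where k: "Q = 2 ^ k"
    using assms by blast
  have CHAR: "CHAR('a) = 2"
    using assms(1,3) k by (intro finite_field_CHAR_eq_2) (cases k; simp)
  have two: "(2::'a) = 0"
    using of_nat_CHAR[where 'a = 'a] CHAR by simp
  have frob: "(x + y) ^ Q = x ^ Q + y ^ Q" for x y :: 'a
    using freshmans_dream'[of Q k x y] CHAR k by simp
  define a where "a = u ^ (Q - 1)"
  define b where "b = v ^ (Q - 1)"
  have ab: "a + b = 1" "a \<noteq> 0" "b \<noteq> 0"
    using assms by (simp_all add: a_def b_def)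
  have Q3: "Q ^ 3 - 1 = (Q - 1) * (1 + Q + Q ^ 2)"
    by (simp add: r eval_nat_numeral algebra_simps)
  have norm: "y * y ^ Q * (y ^ Q) ^ Q = 1" if "y = x ^ (Q - 1)" "x \<noteq> 0" for x y :: 'a
  proof -
    have "y * y ^ Q * (y ^ Q) ^ Q = y ^ (1 + Q + Q ^ 2)"
      by (simp add: power_add power_mult power2_eq_square)
    also have "\<dots> = x ^ (CARD('a) - 1)"
      unfolding that(1) assms(3) Q3 by (rule power_mult [symmetric])
    finally show ?thesis
      using finite_field_power_card_minus_1 that by metis
  qed
  define c where "c = a ^ Q"
  define d where "d = c ^ Q"
  have b: "b = 1 + a" "b ^ Q = 1 + c" "(b ^ Q) ^ Q = 1 + d"
  proof -
    have "b = 1 + a - 2 * a"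
      using ab by (simp add: algebra_simps)
    thus "b = 1 + a"
      by (simp add: two)
    thus "b ^ Q = 1 + c" "(b ^ Q) ^ Q = 1 + d"
      by (simp_all add: frob c_def d_def)
  qed
  have norm_a: "a * c * d = 1"
    using norm[OF a_def] assms by (simp add: c_def d_def)
  have norm_b: "(1 + a) * (1 + c) * (1 + d) = 1"
    using norm[OF b_def] assms b by simp
  have "(c * (1 + a) - 1) * (a * c - (1 + a)) = 0"
  proof -
    \<comment> \<open>The multipliers of the two norm relations are chosen so that \<open>d\<close>
      cancels; the identity holds in any commutative ring, and characteristic 2 only kills its last
      term.\<close>
    have "(c * (1 + a) - 1) * (a * c - (1 + a)) =
            a * c * ((1 + a) * (1 + c) * (1 + d) - 1) - (1 + a) * (1 + c) * (a * c * d - 1)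
            - 2 * (c * (1 + a) ^ 2)"
      by algebra
    thus ?thesis
      by (simp only: norm_a norm_b two) simp
  qed
  hence cases: "c * b = 1 \<or> a * c = b"
    using b by auto
  have subfield: "\<exists>w. t = w ^ 3" if "t ^ (Q - 1) = 1" for t :: 'a
  proof (rule finite_field_nth_power_if_power_eq_1)
    have "1 + Q + Q ^ 2 = 3 * (1 + 3 * r + 3 * r ^ 2)"
      by (simp add: r power2_eq_square algebra_simps)
    thus "CARD('a) - 1 = 3 * ((Q - 1) * (1 + 3 * r + 3 * r ^ 2))"
      using assms(3) Q3 by simp
    show "t ^ ((Q - 1) * (1 + 3 * r + 3 * r ^ 2)) = 1"
      by (simp only: power_mult that power_one)
  qed
  from cases show ?thesis
  proof
    assume "c * b = 1"
    hence "(v * u ^ Q) ^ (Q - 1) = 1"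
      by (simp add: a_def b_def c_def power_mult_distrib mult.commute flip: power_mult)
    then obtain w where w: "v * u ^ Q = w ^ 3"
      using subfield by blast
    have "u ^ Q = u * (u ^ r) ^ 3"
      by (simp add: r mult.commute flip: power_mult)
    hence "u * v = (w / u ^ r) ^ 3"
      using w assms(4) by (simp add: power_divide field_simps)
    thus ?thesis ..
  next
    assume *: "a * c = b"
    have "(u ^ (Q + 1)) ^ (Q - 1) = a * c"
      by (simp add: a_def c_def mult.commute power_add power_mult_distrib flip: power_mult)
    hence "(v / u ^ (Q + 1)) ^ (Q - 1) = 1"
      using * ab by (simp add: power_divide b_def)
    then obtain w where w: "v / u ^ (Q + 1) = w ^ 3"
      using subfield by blast
    \<comment> \<open>Here \<open>Q + 2 = 3 * (r + 1)\<close>.\<close>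
    have "u * u ^ (Q + 1) = (u ^ (r + 1)) ^ 3"
      by (simp add: r mult.commute numeral_3_eq_3 flip: power_mult power_Suc)
    hence "u * v = (w * u ^ (r + 1)) ^ 3"
      using w assms(4) by (simp add: power_mult_distrib field_simps)
    thus ?thesis ..
  qed
qed

end
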